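(* Let $R$ be a PID which is not a field. If $M$ is a nonzero divisible $R$-module, then $\sigma(M) = |\mathbb{Z}|$. More generally, $\sigma(M) \leq |\mathbb{Z}|$ for every $R$-module $M$ that is not reduced.
   Context: The covering number $\sigma(M)$ of an $R$-module $M$ is the smallest cardinal $\aleph$ (possibly infinite) such that $M$ is a union of $\aleph$-many proper $R$-submodules; the assertions about $\sigma(M)$ include that some covering of $M$ by proper submodules exists. An $R$-module $M$ is divisible if $rM = M$ for every nonzero $r \in R$; it is reduced if it has no nonzero divisible submodule. *)

theory Defs
  imports "HOL-Algebra.Algebra"
begin

unbundle cardinal_syntax

definition divisible_module ::
    "('a, 'r) ring_scheme \<Rightarrow> ('a, 'b, 'm) module_scheme \<Rightarrow> bool" where
  "divisible_module R M \<longleftrightarrow>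
     (\<forall>r \<in> carrier R - {\<zero>\<^bsub>R\<^esub>}. (\<lambda>x. r \<odot>\<^bsub>M\<^esub> x) ` carrier M = carrier M)"

definition reduced_module ::
    "('a, 'r) ring_scheme \<Rightarrow> ('a, 'b, 'm) module_scheme \<Rightarrow> bool" where
  "reduced_module R M \<longleftrightarrow>
     \<not> (\<exists>N. submodule N R M \<and> N \<noteq> {\<zero>\<^bsub>M\<^esub>} \<and> divisible_module R (M\<lparr>carrier := N\<rparr>))"

text \<open>Coverings are sets of submodules rather than indexed families; discarding repetitions
  from a family never increases its cardinality, so the least cardinal is the same.\<close>

definition proper_covering ::
    "('a, 'r) ring_scheme \<Rightarrow> ('a, 'b, 'm) module_scheme \<Rightarrow> 'b set set \<Rightarrow> bool" where
  "proper_covering R M C \<longleftrightarrow>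
     (\<forall>N \<in> C. submodule N R M \<and> N \<noteq> carrier M) \<and> \<Union>C = carrier M"

definition coverable ::
    "('a, 'r) ring_scheme \<Rightarrow> ('a, 'b, 'm) module_scheme \<Rightarrow> bool" where
  "coverable R M \<longleftrightarrow> (\<exists>C. proper_covering R M C)"

text \<open>The covering number is the cardinal of a covering of least cardinality. Its value is
  meaningful only for coverable modules, so coverability has to be asserted alongside
  any statement about it.\<close>

definition covering_number ::
    "('a, 'r) ring_scheme \<Rightarrow> ('a, 'b, 'm) module_scheme \<Rightarrow> 'b set rel" where
  "covering_number R M =
     |SOME C. proper_covering R M C \<and> (\<forall>D. proper_covering R M D \<longrightarrow> |C| \<le>o |D| )|"

lemma covering_number_least:
  assumes "coverable R M"
  shows "\<exists>C. proper_covering R M C \<and> covering_number R M = |C|"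
    and "proper_covering R M D \<Longrightarrow> covering_number R M \<le>o |D|"
proof -
  let ?P = "\<lambda>C. proper_covering R M C \<and> (\<forall>D. proper_covering R M D \<longrightarrow> |C| \<le>o |D| )"
  have "\<exists>r \<in> card_of ` {C. proper_covering R M C}.
          \<forall>r' \<in> card_of ` {C. proper_covering R M C}. r \<le>o r'"
    using assms by (intro exists_minim_Card_order) (auto simp: coverable_def)
  hence "\<exists>C. ?P C" by auto
  hence "?P (SOME C. ?P C)" by (rule someI_ex)
  thus "\<exists>C. proper_covering R M C \<and> covering_number R M = |C|"
    and "proper_covering R M D \<Longrightarrow> covering_number R M \<le>o |D|"
    unfolding covering_number_def by blast+
qed

end

theory Submission
  imports Defs
begin

text \<open>
  Two estimates carry the proof.

  A divisible module over an infinite domain is not a finite union of proper submodules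
  (\<open>divisible_mem_of_finite_Union\<close>). Vector spaces over an infinite field have this property
  because among the points \<open>y + s z\<close> of a line two must lie in the same member of the covering, so
  that \<open>(s - t) z\<close> lies there too, and \<open>s - t\<close> can be cancelled. Here it cannot be cancelled, but
  only finitely many differences occur, and divisibility lets one choose \<open>z\<close> in advance such that a
  given element \<open>x\<close> is a multiple of every \<open>(s - t) z\<close>.

  A module over a noetherian domain that is not a field has a countable covering by proper submodules
  as soon as it is not reduced (\<open>countable_proper_covering\<close>). The usual argument splits off the
  divisible submodule \<open>D\<close> and finds a quotient of it that is a Pruefer module, the union of the
  kernels of the powers of a prime. The same covering arises without any
  structure theory. Take a nonzero \<open>x\<close> in \<open>D\<close>, a submodule \<open>N\<close> maximal subject to \<open>x \<notin> N\<close>, and a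
  nonzero ring element \<open>p\<close> with \<open>p x \<in> N\<close>. The submodules \<open>F n = {m. p^n m \<in> N}\<close> are proper
  because \<open>x = p^n d\<close> for some \<open>d\<close> in \<open>D\<close>. They cover: by maximality of \<open>N\<close>, each \<open>w \<notin> N\<close> has a
  multiple \<open>r w\<close> congruent to \<open>x\<close> modulo \<open>N\<close>, so \<open>r w\<close> is outside \<open>N\<close> while \<open>r p w\<close> is in \<open>N\<close>.
  If no \<open>p^n m\<close> were in \<open>N\<close>, taking \<open>w = p^n m\<close> would show that the annihilator of \<open>p^n m\<close> modulo
  \<open>N\<close> grows strictly with \<open>n\<close>, which a noetherian ring forbids.

  A nonzero divisible module is not reduced, so both estimates apply to it.
\<close>

section \<open>Domains that are not fields\<close>

lemma (in cring) exists_nonzero_nonunit: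
  assumes "\<one> \<noteq> \<zero>" and "\<not> field R"
  obtains t where "t \<in> carrier R" "t \<noteq> \<zero>" "\<And>s. s \<in> carrier R \<Longrightarrow> t \<otimes> s \<noteq> \<one>"
  using cring_fieldI2 assms by auto

text \<open>In a finite domain multiplication by a nonzero element is injective, hence surjective.\<close>

lemma (in domain) infinite_carrier_if_not_field:
  assumes "\<not> field R"
  shows "infinite (carrier R)"
proof
  assume fin: "finite (carrier R)"
  have "\<exists>b \<in> carrier R. a \<otimes> b = \<one>" if a: "a \<in> carrier R" "a \<noteq> \<zero>" for a
  proof -
    have "inj_on (\<lambda>b. a \<otimes> b) (carrier R)"
      using a by (auto intro!: inj_onI simp: m_lcancel)
    moreover have "(\<lambda>b. a \<otimes> b) ` carrier R \<subseteq> carrier R"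
      using a by auto
    ultimately have "(\<lambda>b. a \<otimes> b) ` carrier R = carrier R"
      by (intro endo_inj_surj[OF fin])
    then show ?thesis
      by (metis image_iff one_closed)
  qed
  then have "field R"
    by (intro cring_fieldI2) auto
  with assms show False ..
qed

lemma (in domain) exists_nonzero_common_multiple:
  assumes "finite A" and "A \<subseteq> carrier R - {\<zero>}"
  shows "\<exists>r \<in> carrier R - {\<zero>}. \<forall>a \<in> A. \<exists>b \<in> carrier R. r = b \<otimes> a"
  using assms
proof (induction A)
  case empty
  then show ?case by (auto intro!: bexI[of _ \<one>])
next
  case (insert a A)
  then obtain r where r: "r \<in> carrier R - {\<zero>}" "\<forall>a \<in> A. \<exists>b \<in> carrier R. r = b \<otimes> a"
    by auto
  have a: "a \<in> carrier R" "a \<noteq> \<zero>" using insert.prems by auto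
  have "\<exists>b \<in> carrier R. r \<otimes> a = b \<otimes> c" if c: "c \<in> insert a A" for c
  proof (cases "c = a")
    case True
    then show ?thesis using r by auto
  next
    case False
    then obtain b where b: "b \<in> carrier R" "r = b \<otimes> c" using r c by auto
    have "c \<in> carrier R" using c insert.prems by auto
    then have "r \<otimes> a = (a \<otimes> b) \<otimes> c"
      using a b by (simp add: m_ac)
    then show ?thesis using a b by blast
  qed
  moreover have "r \<otimes> a \<in> carrier R - {\<zero>}"
    using r a integral[of r a] by auto
  ultimately show ?case by blast
qed

section \<open>Submodules and maximal submodules avoiding an element\<close>

context module
begin

lemma zero_mem_submodule:
  assumes "submodule N R M"
  shows "\<zero>\<^bsub>M\<^esub> \<in> N"
  using subgroup.one_closed[OF submodule.axioms(1)[OF assms]] by simp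

lemma diff_mem_submodule:
  assumes "submodule N R M" and "x \<in> N" and "y \<in> N"
  shows "x \<ominus>\<^bsub>M\<^esub> y \<in> N"
  using submoduleE[OF assms(1)] assms(2,3) by (simp add: a_minus_def)

lemma smult_diff_distr:
  assumes "a \<in> carrier R" and "x \<in> carrier M" and "y \<in> carrier M"
  shows "a \<odot>\<^bsub>M\<^esub> (x \<ominus>\<^bsub>M\<^esub> y) = a \<odot>\<^bsub>M\<^esub> x \<ominus>\<^bsub>M\<^esub> a \<odot>\<^bsub>M\<^esub> y"
  using assms by (simp add: a_minus_def smult_r_distr smult_r_minus)

lemma diff_smult_distr:
  assumes "a \<in> carrier R" and "b \<in> carrier R" and "x \<in> carrier M"
  shows "(a \<ominus> b) \<odot>\<^bsub>M\<^esub> x = a \<odot>\<^bsub>M\<^esub> x \<ominus>\<^bsub>M\<^esub> b \<odot>\<^bsub>M\<^esub> x"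
  using assms by (simp add: a_minus_def smult_l_distr smult_l_minus)

lemma mem_submodule_if_diff_mem:
  assumes "submodule N R M" and "x \<in> carrier M" and "x \<ominus>\<^bsub>M\<^esub> y \<in> N" and "y \<in> N"
  shows "x \<in> N"
proof -
  have y: "y \<in> carrier M" using assms submoduleE(1) by blast
  have "(x \<ominus>\<^bsub>M\<^esub> y) \<oplus>\<^bsub>M\<^esub> y = x"
    using assms(2) y by (simp add: a_minus_def M.a_assoc M.l_neg)
  then show ?thesis using submoduleE(5)[OF assms(1,3,4)] by simp
qed

lemma submodule_smult_vimage:
  assumes "submodule N R M" and a: "a \<in> carrier R"
  shows "submodule {m \<in> carrier M. a \<odot>\<^bsub>M\<^esub> m \<in> N} R M"
proof (rule submoduleI; clarsimp simp: a)
  show "\<zero>\<^bsub>M\<^esub> \<in> N" by (rule zero_mem_submodule[OF assms(1)])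
next
  fix x assume "x \<in> carrier M" "a \<odot>\<^bsub>M\<^esub> x \<in> N"
  then show "a \<odot>\<^bsub>M\<^esub> (\<ominus>\<^bsub>M\<^esub> x) \<in> N"
    using submoduleE(3)[OF assms(1)] a by (simp add: smult_r_minus)
next
  fix x y assume "x \<in> carrier M" "a \<odot>\<^bsub>M\<^esub> x \<in> N" "y \<in> carrier M" "a \<odot>\<^bsub>M\<^esub> y \<in> N"
  then show "a \<odot>\<^bsub>M\<^esub> (x \<oplus>\<^bsub>M\<^esub> y) \<in> N"
    using submoduleE(5)[OF assms(1)] a by (simp add: smult_r_distr)
next
  fix b x assume x: "b \<in> carrier R" "x \<in> carrier M" "a \<odot>\<^bsub>M\<^esub> x \<in> N"
  have "a \<odot>\<^bsub>M\<^esub> (b \<odot>\<^bsub>M\<^esub> x) = b \<odot>\<^bsub>M\<^esub> (a \<odot>\<^bsub>M\<^esub> x)"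
    using a x by (simp flip: smult_assoc1 add: m_comm)
  then show "a \<odot>\<^bsub>M\<^esub> (b \<odot>\<^bsub>M\<^esub> x) \<in> N"
    using submoduleE(4)[OF assms(1)] x by simp
qed

lemma ideal_colon:
  assumes "submodule N R M" and w: "w \<in> carrier M"
  shows "ideal {a \<in> carrier R. a \<odot>\<^bsub>M\<^esub> w \<in> N} R"
proof (rule idealI)
  show "ring R" by (rule R.ring_axioms)
  show "subgroup {a \<in> carrier R. a \<odot>\<^bsub>M\<^esub> w \<in> N} (add_monoid R)"
  proof (rule R.add.subgroupI)
    show "{a \<in> carrier R. a \<odot>\<^bsub>M\<^esub> w \<in> N} \<noteq> {}"
      using zero_mem_submodule[OF assms(1)] w by (auto intro!: exI[of _ \<zero>])
  qed (use w submoduleE[OF assms(1)] in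
        \<open>auto simp: smult_l_distr smult_l_minus simp flip: a_inv_def\<close>)
next
  fix a b assume a: "a \<in> {a \<in> carrier R. a \<odot>\<^bsub>M\<^esub> w \<in> N}" and b: "b \<in> carrier R"
  then show "b \<otimes> a \<in> {a \<in> carrier R. a \<odot>\<^bsub>M\<^esub> w \<in> N}"
    using submoduleE(4)[OF assms(1)] w by (simp add: smult_assoc1)
  then show "a \<otimes> b \<in> {a \<in> carrier R. a \<odot>\<^bsub>M\<^esub> w \<in> N}"
    using a b by (simp add: m_comm)
qed

text \<open>This is the sum of \<open>N\<close> and the cyclic submodule generated by \<open>m\<close>, written as the set of
  elements that are congruent to a multiple of \<open>m\<close> modulo \<open>N\<close>, the form in which it is needed
  below.\<close>

lemma submodule_add_cyclic:
  assumes "submodule N R M" and m: "m \<in> carrier M"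
  shows "submodule {y \<in> carrier M. \<exists>r \<in> carrier R. y \<ominus>\<^bsub>M\<^esub> r \<odot>\<^bsub>M\<^esub> m \<in> N} R M"
    (is "submodule ?K R M")
proof (rule submoduleI)
  note N = submoduleE[OF assms(1)]
  show "?K \<subseteq> carrier M" by auto
  show "\<zero>\<^bsub>M\<^esub> \<in> ?K"
    using zero_mem_submodule[OF assms(1)] N(3) m
    by (auto intro!: bexI[of _ \<zero>] simp: a_minus_def)
next
  fix a x assume a: "a \<in> carrier R" and "x \<in> ?K"
  then obtain r where r: "x \<in> carrier M" "r \<in> carrier R" "x \<ominus>\<^bsub>M\<^esub> r \<odot>\<^bsub>M\<^esub> m \<in> N" by auto
  have "a \<odot>\<^bsub>M\<^esub> (x \<ominus>\<^bsub>M\<^esub> r \<odot>\<^bsub>M\<^esub> m) = a \<odot>\<^bsub>M\<^esub> x \<ominus>\<^bsub>M\<^esub> (a \<otimes> r) \<odot>\<^bsub>M\<^esub> m"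
    using a r m by (simp add: smult_diff_distr smult_assoc1)
  then show "a \<odot>\<^bsub>M\<^esub> x \<in> ?K"
    using submoduleE(4)[OF assms(1) a r(3)] a r by auto
next
  fix x y assume "x \<in> ?K" "y \<in> ?K"
  then obtain r s where r: "x \<in> carrier M" "r \<in> carrier R" "x \<ominus>\<^bsub>M\<^esub> r \<odot>\<^bsub>M\<^esub> m \<in> N"
    and s: "y \<in> carrier M" "s \<in> carrier R" "y \<ominus>\<^bsub>M\<^esub> s \<odot>\<^bsub>M\<^esub> m \<in> N" by auto
  have "(x \<ominus>\<^bsub>M\<^esub> r \<odot>\<^bsub>M\<^esub> m) \<oplus>\<^bsub>M\<^esub> (y \<ominus>\<^bsub>M\<^esub> s \<odot>\<^bsub>M\<^esub> m) = (x \<oplus>\<^bsub>M\<^esub> y) \<ominus>\<^bsub>M\<^esub> (r \<oplus> s) \<odot>\<^bsub>M\<^esub> m"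
    using r s m by (simp add: smult_l_distr a_minus_def M.minus_add M.a_ac)
  then show "x \<oplus>\<^bsub>M\<^esub> y \<in> ?K"
    using submoduleE(5)[OF assms(1) r(3) s(3)] r s by auto
next
  fix x assume "x \<in> ?K"
  then obtain r where r: "x \<in> carrier M" "r \<in> carrier R" "x \<ominus>\<^bsub>M\<^esub> r \<odot>\<^bsub>M\<^esub> m \<in> N" by auto
  have "\<ominus>\<^bsub>M\<^esub> (x \<ominus>\<^bsub>M\<^esub> r \<odot>\<^bsub>M\<^esub> m) = \<ominus>\<^bsub>M\<^esub> x \<ominus>\<^bsub>M\<^esub> (\<ominus> r) \<odot>\<^bsub>M\<^esub> m"
    using r m by (simp add: smult_l_minus a_minus_def M.minus_add)
  then show "\<ominus>\<^bsub>M\<^esub> x \<in> ?K"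
    using submoduleE(3)[OF assms(1) r(3)] r by auto
qed

lemma submodule_Union_chain:
  assumes "subset.chain {N. submodule N R M} C" and "C \<noteq> {}"
  shows "submodule (\<Union>C) R M"
proof (rule submoduleI)
  have sub: "submodule N R M" if "N \<in> C" for N
    using assms(1) that by (auto simp: subset.chain_def)
  show "\<Union>C \<subseteq> carrier M" using sub submoduleE(1) by blast
  show "\<zero>\<^bsub>M\<^esub> \<in> \<Union>C" using sub zero_mem_submodule assms(2) by blast
  show "\<ominus>\<^bsub>M\<^esub> a \<in> \<Union>C" if "a \<in> \<Union>C" for a using sub submoduleE(3) that by blast
  show "a \<odot>\<^bsub>M\<^esub> x \<in> \<Union>C" if "a \<in> carrier R" "x \<in> \<Union>C" for a x
    using sub submoduleE(4) that by blast
  fix a b assume "a \<in> \<Union>C" "b \<in> \<Union>C"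
  then obtain N K where NK: "N \<in> C" "K \<in> C" "a \<in> N" "b \<in> K" by auto
  then have "N \<subseteq> K \<or> K \<subseteq> N" using assms(1) by (auto simp: subset.chain_def)
  then show "a \<oplus>\<^bsub>M\<^esub> b \<in> \<Union>C" using NK sub submoduleE(5) by blast
qed

text \<open>Zorn's lemma gives \<open>N\<close>. An \<open>m\<close> outside \<open>N\<close> makes \<open>N + R m\<close> strictly larger than \<open>N\<close>, so it
  contains \<open>x\<close>. In the quotient by \<open>N\<close>, the image of \<open>x\<close> thus lies in every nonzero submodule.\<close>

lemma exists_maximal_submodule_avoiding:
  assumes x: "x \<in> carrier M" "x \<noteq> \<zero>\<^bsub>M\<^esub>"
  obtains N where "submodule N R M" "x \<notin> N"
    "\<And>m. \<lbrakk>m \<in> carrier M; m \<notin> N\<rbrakk> \<Longrightarrow> \<exists>r \<in> carrier R. x \<ominus>\<^bsub>M\<^esub> r \<odot>\<^bsub>M\<^esub> m \<in> N"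
proof -
  let ?S = "{N. submodule N R M \<and> x \<notin> N}"
  have "\<exists>N \<in> ?S. \<forall>K \<in> ?S. N \<subseteq> K \<longrightarrow> K = N"
  proof (rule subset_Zorn_nonempty)
    have "submodule {\<zero>\<^bsub>M\<^esub>} R M" by (rule submoduleI) auto
    then show "?S \<noteq> {}" using x by auto
    fix C assume C: "C \<noteq> {}" "subset.chain ?S C"
    then have "subset.chain {N. submodule N R M} C" by (auto simp: subset.chain_def)
    then show "\<Union>C \<in> ?S"
      using submodule_Union_chain C by (auto simp: subset.chain_def)
  qed
  then obtain N where N: "submodule N R M" "x \<notin> N"
    and max: "\<And>K. \<lbrakk>submodule K R M; x \<notin> K; N \<subseteq> K\<rbrakk> \<Longrightarrow> K = N" by blast
  have "\<exists>r \<in> carrier R. x \<ominus>\<^bsub>M\<^esub> r \<odot>\<^bsub>M\<^esub> m \<in> N" if m: "m \<in> carrier M" "m \<notin> N" for m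
  proof (rule ccontr)
    let ?K = "{y \<in> carrier M. \<exists>r \<in> carrier R. y \<ominus>\<^bsub>M\<^esub> r \<odot>\<^bsub>M\<^esub> m \<in> N}"
    assume "\<not> ?thesis"
    then have "x \<notin> ?K" by auto
    moreover have "N \<subseteq> ?K"
    proof
      fix y assume y: "y \<in> N"
      then have "y \<in> carrier M" using submoduleE(1)[OF N(1)] by blast
      then have "y \<ominus>\<^bsub>M\<^esub> \<zero> \<odot>\<^bsub>M\<^esub> m = y" using m by (simp add: a_minus_def)
      with y \<open>y \<in> carrier M\<close> show "y \<in> ?K" by (metis (mono_tags, lifting) R.zero_closed mem_Collect_eq)
    qed
    ultimately have "?K = N" using max submodule_add_cyclic[OF N(1) m(1)] by blast
    moreover have "m \<in> ?K"
    proof -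
      have "m \<ominus>\<^bsub>M\<^esub> \<one> \<odot>\<^bsub>M\<^esub> m \<in> N"
        using m zero_mem_submodule[OF N(1)] by (simp add: a_minus_def M.r_neg)
      then show ?thesis using m by blast
    qed
    ultimately show False using m by blast
  qed
  then show ?thesis using that N by blast
qed

section \<open>Divisible modules are not finite unions of proper submodules\<close>

text \<open>The induction on \<open>C\<close> provides, besides some \<open>y\<close> outside \<open>N\<close>, an \<open>x\<close> that lies in \<open>N\<close> only.
  Any \<open>z\<close> with \<open>r z = x\<close> is then confined to \<open>N\<close> as well, since a member of \<open>C\<close> containing \<open>z\<close>
  would contain \<open>x\<close>. Hence all points \<open>y + s z\<close> avoid \<open>N\<close>, and the pigeonhole principle applies to
  the members of \<open>C\<close>.\<close>

lemma divisible_mem_of_finite_Union: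
  assumes "domain R" and inf: "infinite (carrier R)" and div: "divisible_module R M"
    and "finite C" and "\<And>N. N \<in> C \<Longrightarrow> submodule N R M" and "carrier M \<subseteq> \<Union>C"
  shows "carrier M \<in> C"
  using assms(4-6)
proof (induction C)
  case empty
  then show ?case using M.zero_closed by blast
next
  case (insert N C)
  interpret domain R by fact
  note N = insert.prems(1)[of N, simplified]
  show ?case
  proof (rule ccontr)
    assume not: "carrier M \<notin> insert N C"
    then obtain x where x: "x \<in> carrier M" "x \<notin> \<Union>C"
      using insert.IH insert.prems(1) by blast
    obtain y where y: "y \<in> carrier M" "y \<notin> N"
      using not submoduleE(1)[OF N] by blast
    obtain S where S: "S \<subseteq> carrier R" "finite S" "card S = Suc (card C)"
      using infinite_arbitrarily_large[OF inf] by metis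
    \<comment> \<open>A common multiple \<open>r\<close> of the differences is fixed before \<open>z\<close>, so that any collision below
      already forces \<open>x\<close> into a member of \<open>C\<close>.\<close>
    let ?D = "(\<lambda>(s, t). s \<ominus> t) ` {(s, t) \<in> S \<times> S. s \<noteq> t}"
    have "finite ?D"
      by (rule finite_imageI, rule finite_subset[of _ "S \<times> S"]) (use S(2) in auto)
    moreover have "?D \<subseteq> carrier R - {\<zero>}"
      using S(1) by (auto simp: subset_iff)
    ultimately obtain r where r: "r \<in> carrier R - {\<zero>}"
      and mult: "\<forall>d \<in> ?D. \<exists>b \<in> carrier R. r = b \<otimes> d"
      using exists_nonzero_common_multiple by blast
    obtain z where z: "z \<in> carrier M" "r \<odot>\<^bsub>M\<^esub> z = x"
      using div r x unfolding divisible_module_def by (metis image_iff)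
    have "z \<notin> \<Union>C"
      using x z r insert.prems(1) submoduleE(4) by blast
    then have zN: "z \<in> N" using insert.prems(2) z by blast
    have "y \<oplus>\<^bsub>M\<^esub> s \<odot>\<^bsub>M\<^esub> z \<in> \<Union>C" if s: "s \<in> S" for s
    proof -
      have sz: "s \<odot>\<^bsub>M\<^esub> z \<in> N" using s S zN submoduleE(4)[OF N] by blast
      have sR: "s \<in> carrier R" using s S by blast
      have eq: "(y \<oplus>\<^bsub>M\<^esub> s \<odot>\<^bsub>M\<^esub> z) \<ominus>\<^bsub>M\<^esub> s \<odot>\<^bsub>M\<^esub> z = y"
        using y z sR by (simp add: a_minus_def M.a_assoc M.r_neg)
      have "y \<oplus>\<^bsub>M\<^esub> s \<odot>\<^bsub>M\<^esub> z \<notin> N"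
        using diff_mem_submodule[OF N _ sz, of "y \<oplus>\<^bsub>M\<^esub> s \<odot>\<^bsub>M\<^esub> z"] eq y by auto
      moreover have "y \<oplus>\<^bsub>M\<^esub> s \<odot>\<^bsub>M\<^esub> z \<in> carrier M" using y z sR by simp
      ultimately show ?thesis using insert.prems(2) by blast
    qed
    then have "\<forall>s \<in> S. \<exists>K. K \<in> C \<and> y \<oplus>\<^bsub>M\<^esub> s \<odot>\<^bsub>M\<^esub> z \<in> K"
      by blast
    then obtain g where "\<forall>s \<in> S. g s \<in> C \<and> y \<oplus>\<^bsub>M\<^esub> s \<odot>\<^bsub>M\<^esub> z \<in> g s"
      using bchoice[of S "\<lambda>s K. K \<in> C \<and> y \<oplus>\<^bsub>M\<^esub> s \<odot>\<^bsub>M\<^esub> z \<in> K"] by blast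
    then have g: "g s \<in> C" "y \<oplus>\<^bsub>M\<^esub> s \<odot>\<^bsub>M\<^esub> z \<in> g s" if "s \<in> S" for s
      using that by blast+
    have "\<not> inj_on g S"
    proof
      assume "inj_on g S"
      then have "card S \<le> card C"
        using g(1) insert.hyps(1) by (intro card_inj_on_le[of g S C]) auto
      then show False using S(3) by simp
    qed
    then obtain s t where st: "s \<in> S" "t \<in> S" "s \<noteq> t" "g s = g t"
      unfolding inj_on_def by auto
    have stR: "s \<in> carrier R" "t \<in> carrier R" using st S by auto
    have K: "submodule (g s) R M" using g st insert.prems(1) by blast
    have "(y \<oplus>\<^bsub>M\<^esub> s \<odot>\<^bsub>M\<^esub> z) \<ominus>\<^bsub>M\<^esub> (y \<oplus>\<^bsub>M\<^esub> t \<odot>\<^bsub>M\<^esub> z) = s \<odot>\<^bsub>M\<^esub> z \<ominus>\<^bsub>M\<^esub> t \<odot>\<^bsub>M\<^esub> z"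
      using y z stR
      by (simp add: a_minus_def M.minus_add M.a_ac M.r_neg M.r_neg1 M.r_neg2)
    also have "\<dots> = (s \<ominus> t) \<odot>\<^bsub>M\<^esub> z"
      using stR z by (simp add: diff_smult_distr)
    finally have dz: "(s \<ominus> t) \<odot>\<^bsub>M\<^esub> z \<in> g s"
      using diff_mem_submodule[OF K] g st by metis
    obtain b where b: "b \<in> carrier R" "r = b \<otimes> (s \<ominus> t)"
      using mult st by blast
    have "x = b \<odot>\<^bsub>M\<^esub> ((s \<ominus> t) \<odot>\<^bsub>M\<^esub> z)"
      using z b stR by (simp flip: smult_assoc1)
    then have "x \<in> g s" using submoduleE(4)[OF K b(1) dz] by simp
    then show False using x g st by blast
  qed
qed

section \<open>Nonreduced modules are countable unions of proper submodules\<close>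

text \<open>The covering consists of the submodules of elements that a power of \<open>p\<close> carries into \<open>N\<close>. A
  single \<open>p\<close> is what keeps it countable: for the union over all nonzero ring elements instead of
  the powers of \<open>p\<close>, the number of members could be as large as the ring.\<close>

lemma countable_proper_covering:
  assumes "noetherian_domain R" and nf: "\<not> field R" and nr: "\<not> reduced_module R M"
  obtains C where "proper_covering R M C" "|C| \<le>o |UNIV :: nat set|"
proof -
  interpret noetherian_domain R by fact
  obtain D where D: "submodule D R M" "D \<noteq> {\<zero>\<^bsub>M\<^esub>}"
    and div: "\<And>r. r \<in> carrier R - {\<zero>} \<Longrightarrow> (\<lambda>x. r \<odot>\<^bsub>M\<^esub> x) ` D = D"
    using nr unfolding reduced_module_def divisible_module_def by auto
  obtain x where x: "x \<in> D" "x \<noteq> \<zero>\<^bsub>M\<^esub>"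
    using D zero_mem_submodule by blast
  have xM: "x \<in> carrier M" using x D submoduleE(1) by blast
  obtain N where N: "submodule N R M" "x \<notin> N"
    and max: "\<And>m. \<lbrakk>m \<in> carrier M; m \<notin> N\<rbrakk> \<Longrightarrow> \<exists>r \<in> carrier R. x \<ominus>\<^bsub>M\<^esub> r \<odot>\<^bsub>M\<^esub> m \<in> N"
    using exists_maximal_submodule_avoiding[OF xM x(2)] by blast
  \<comment> \<open>Take a nonzero nonunit \<open>t\<close>. If \<open>t x\<close> is not in \<open>N\<close>, then some \<open>s t x\<close> is congruent to \<open>x\<close>
    modulo \<open>N\<close>, and \<open>p = 1 - t s\<close> is nonzero because \<open>t\<close> is not a unit.\<close>
  obtain p where p: "p \<in> carrier R" "p \<noteq> \<zero>" "p \<odot>\<^bsub>M\<^esub> x \<in> N"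
  proof -
    obtain t where t: "t \<in> carrier R" "t \<noteq> \<zero>" "\<And>s. s \<in> carrier R \<Longrightarrow> t \<otimes> s \<noteq> \<one>"
      using exists_nonzero_nonunit[OF one_not_zero nf] by blast
    show thesis
    proof (cases "t \<odot>\<^bsub>M\<^esub> x \<in> N")
      case True
      then show ?thesis using that t by blast
    next
      case False
      then obtain s where s: "s \<in> carrier R" "x \<ominus>\<^bsub>M\<^esub> s \<odot>\<^bsub>M\<^esub> (t \<odot>\<^bsub>M\<^esub> x) \<in> N"
        using max t xM by blast
      have "(\<one> \<ominus> t \<otimes> s) \<odot>\<^bsub>M\<^esub> x = x \<ominus>\<^bsub>M\<^esub> s \<odot>\<^bsub>M\<^esub> (t \<odot>\<^bsub>M\<^esub> x)"
        using s t xM by (simp add: diff_smult_distr smult_assoc1 m_comm[of t s])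
      moreover have "\<one> \<ominus> t \<otimes> s \<noteq> \<zero>"
        using t s by (metis R.m_closed R.one_closed R.r_right_minus_eq)
      ultimately show ?thesis
        using that s t by (metis R.m_closed R.minus_closed R.one_closed)
    qed
  qed
  define F where "F n = {m \<in> carrier M. (p [^] (n::nat)) \<odot>\<^bsub>M\<^esub> m \<in> N}" for n
  have F_sub: "submodule (F n) R M" for n
    unfolding F_def using submodule_smult_vimage[OF N(1)] p by simp
  have F_proper: "F n \<noteq> carrier M" for n
  proof -
    have "p [^] n \<in> carrier R - {\<zero>}"
      using p by (induction n) (auto simp: integral_iff)
    then obtain d where "d \<in> D" "(p [^] n) \<odot>\<^bsub>M\<^esub> d = x"
      using div x by (metis image_iff)
    then show ?thesis
      using D(1) submoduleE(1) N(2) unfolding F_def by blast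
  qed
  have F_cover: "\<exists>n. m \<in> F n" if m: "m \<in> carrier M" for m
  proof (rule ccontr)
    assume "\<nexists>n. m \<in> F n"
    then have out: "(p [^] n) \<odot>\<^bsub>M\<^esub> m \<notin> N" for n :: nat
      using m by (auto simp: F_def)
    \<comment> \<open>The annihilators of the elements \<open>p^n m\<close> modulo \<open>N\<close>.\<close>
    define J where "J n = {a \<in> carrier R. a \<odot>\<^bsub>M\<^esub> ((p [^] (n::nat)) \<odot>\<^bsub>M\<^esub> m) \<in> N}" for n
    have J_shift: "a \<in> J (Suc n) \<longleftrightarrow> a \<otimes> p \<in> J n" if "a \<in> carrier R" for a n
    proof -
      have "p [^] Suc n \<odot>\<^bsub>M\<^esub> m = p \<odot>\<^bsub>M\<^esub> (p [^] n \<odot>\<^bsub>M\<^esub> m)"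
        unfolding R.nat_pow_Suc2[OF p(1)] using p m by (simp add: smult_assoc1)
      then show ?thesis
        unfolding J_def using that p m by (simp add: smult_assoc1 del: R.nat_pow_Suc)
    qed
    have J_ideal: "ideal (J n) R" for n
      unfolding J_def using ideal_colon[OF N(1)] p m by simp
    have J_carrier: "J n \<subseteq> carrier R" for n by (auto simp: J_def)
    have "J n \<subseteq> J (Suc n)" for n
      using J_shift J_carrier ideal.I_r_closed[OF J_ideal] p(1) by blast
    then have mono: "J i \<subseteq> J j" if "i \<le> j" for i j
      using that by (rule lift_Suc_mono_le)
    have "J i \<subseteq> J j \<or> J j \<subseteq> J i" for i j
      using mono nat_le_linear by blast
    then have "subset.chain {I. ideal I R} (range J)"
      unfolding subset.chain_def using J_ideal by blast
    then obtain n where n: "\<Union>(range J) = J n"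
      using ideal_chain_is_trivial[of "range J"] by auto
    let ?w = "(p [^] n) \<odot>\<^bsub>M\<^esub> m"
    have w: "?w \<in> carrier M" using p m by simp
    obtain r where r: "r \<in> carrier R" "x \<ominus>\<^bsub>M\<^esub> r \<odot>\<^bsub>M\<^esub> ?w \<in> N"
      using max[OF w out] by blast
    \<comment> \<open>Modulo \<open>N\<close> the element \<open>r w\<close> equals \<open>x\<close>, which \<open>p\<close> kills.\<close>
    have u: "x \<ominus>\<^bsub>M\<^esub> r \<odot>\<^bsub>M\<^esub> ?w \<in> carrier M" using xM r w by simp
    have "x \<ominus>\<^bsub>M\<^esub> (x \<ominus>\<^bsub>M\<^esub> r \<odot>\<^bsub>M\<^esub> ?w) = r \<odot>\<^bsub>M\<^esub> ?w"
      using xM r w by (simp add: a_minus_def M.minus_add M.r_neg2)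
    then have "p \<odot>\<^bsub>M\<^esub> x \<ominus>\<^bsub>M\<^esub> p \<odot>\<^bsub>M\<^esub> (x \<ominus>\<^bsub>M\<^esub> r \<odot>\<^bsub>M\<^esub> ?w) = p \<odot>\<^bsub>M\<^esub> (r \<odot>\<^bsub>M\<^esub> ?w)"
      using smult_diff_distr[OF p(1) xM u] by simp
    also have "\<dots> = (r \<otimes> p) \<odot>\<^bsub>M\<^esub> ?w"
      unfolding R.m_comm[OF r(1) p(1)] by (rule smult_assoc1[OF p(1) r(1) w, symmetric])
    finally have "p \<odot>\<^bsub>M\<^esub> x \<ominus>\<^bsub>M\<^esub> p \<odot>\<^bsub>M\<^esub> (x \<ominus>\<^bsub>M\<^esub> r \<odot>\<^bsub>M\<^esub> ?w) = (r \<otimes> p) \<odot>\<^bsub>M\<^esub> ?w" .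
    then have "r \<otimes> p \<in> J n"
      using diff_mem_submodule[OF N(1) p(3) submoduleE(4)[OF N(1) p(1) r(2)]] r p
      by (simp add: J_def)
    then have "r \<in> J n" using J_shift r n by blast
    then have "r \<odot>\<^bsub>M\<^esub> ?w \<in> N" by (simp add: J_def)
    then have "x \<in> N" using mem_submodule_if_diff_mem[OF N(1) xM r(2)] by blast
    with N(2) show False by contradiction
  qed
  have "proper_covering R M (range F)"
    unfolding proper_covering_def
    using F_sub F_proper F_cover by (auto simp: F_def)
  moreover have "|range F| \<le>o |UNIV :: nat set|" by (rule card_of_image)
  ultimately show ?thesis by (rule that)
qed

lemma divisible_not_reduced:
  assumes "carrier M \<noteq> {\<zero>\<^bsub>M\<^esub>}" and "divisible_module R M"
  shows "\<not> reduced_module R M"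
  using assms carrier_is_submodule unfolding reduced_module_def divisible_module_def by auto

end

section \<open>The covering number\<close>

theorem proposition3p2:
  fixes R :: "('a, 'r) ring_scheme" and M :: "('a, 'b, 'm) module_scheme"
  assumes "principal_domain R" and "\<not> field R" and "module R M"
  shows "(carrier M \<noteq> {\<zero>\<^bsub>M\<^esub>} \<and> divisible_module R M \<longrightarrow>
            coverable R M \<and> covering_number R M =o |UNIV :: int set| ) \<and>
         (\<not> reduced_module R M \<longrightarrow>
            coverable R M \<and> covering_number R M \<le>o |UNIV :: int set| )"
proof -
  interpret principal_domain R by fact
  interpret module R M by fact
  have "bij_betw int_decode UNIV UNIV" by (rule bij_int_decode)
  then have nat_int: "|UNIV :: nat set| =o |UNIV :: int set|"
    by (rule card_of_ordIsoI)
  have upper: "coverable R M \<and> covering_number R M \<le>o |UNIV :: int set|"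
    if nr: "\<not> reduced_module R M"
  proof -
    obtain C where C: "proper_covering R M C" "|C| \<le>o |UNIV :: nat set|"
      using countable_proper_covering[OF noetherian_domain_axioms assms(2) nr] by blast
    then have "coverable R M" by (auto simp: coverable_def)
    then show ?thesis
      using covering_number_least(2)[OF _ C(1)] C(2) nat_int
        ordLeq_transitive ordLeq_ordIso_trans by blast
  qed
  have "covering_number R M =o |UNIV :: int set|"
    if nz: "carrier M \<noteq> {\<zero>\<^bsub>M\<^esub>}" and div: "divisible_module R M"
  proof -
    have up: "coverable R M" "covering_number R M \<le>o |UNIV :: int set|"
      using upper divisible_not_reduced[OF nz div] by auto
    obtain C where C: "proper_covering R M C" "covering_number R M = |C|"
      using covering_number_least(1)[OF up(1)] by blast
    have "infinite C"
    proof
      assume "finite C"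
      have "carrier M \<in> C"
        using C(1) unfolding proper_covering_def
        by (intro divisible_mem_of_finite_Union[OF domain_axioms
              infinite_carrier_if_not_field[OF assms(2)] div \<open>finite C\<close>]) auto
      then show False using C(1) unfolding proper_covering_def by blast
    qed
    then have "|UNIV :: nat set| \<le>o |C|" by (simp add: infinite_iff_card_of_nat)
    then have "|UNIV :: int set| \<le>o covering_number R M"
      using C(2) nat_int ordIso_ordLeq_trans ordIso_symmetric by metis
    then show ?thesis using up(2) by (simp add: ordIso_iff_ordLeq)
  qed
  then show ?thesis using upper divisible_not_reduced by blast
qed

end
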